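(* Let $\mathbf P$ be an equiangular hedgehog with $n\ge 3$ sides tangent to a hypocycloid $h$ of order $m$. Then the $\mathcal P$-evolute of $\mathbf P$ is tangent to the curve obtained from the evolute $\mathcal E(h)$ by scaling with the factor $\dfrac{\sin(2\pi m/n)}{m\sin(2\pi/n)}$ with respect to its center.
   Context: A cooriented line $(\alpha,p)$ is the line $x\cos\alpha+y\sin\alpha=p$ with coorienting normal $(\cos\alpha,\sin\alpha)$; it is oriented by the normal turned counterclockwise by $\pi/2$. A cooriented $n$-gon is a cyclic sequence of cooriented lines $l_j=(\alpha_j,p_j)$ (indices mod $n$) with $l_j,l_{j+1}$ meeting at a single point $P_{j+\frac12}$. It is an equiangular hedgehog if all turning angles $\alpha_{j+1}-\alpha_j$ equal $2\pi/n$ modulo $2\pi$. The $\mathcal P$-evolute is the cooriented polygon $(l_1^*,\dots,l_n^* )$, where $l_j^*$ passes through the midpoint of $P_{j-\frac12}P_{j+\frac12}$ and its direction is that of $l_j$ turned counterclockwise by $\pi/2$. A smooth hedgehog is a cooriented closed wave front described by its $2\pi$-periodic support function $p(\alpha)$ (the signed distance from the origin to its tangent line with coorienting normal $(\cos\alpha,\sin\alpha)$). A hypocycloid of order $m$ centered at the origin is the hedgehog with support function $p(\alpha)=a\cos m\alpha+b\sin m\alpha$. The evolute $\mathcal E(h)$ of a hedgehog $h$ is the envelope of its normals; its support function is $p'(\alpha-\pi/2)$ if that of $h$ is $p(\alpha)$. A cooriented line $(\alpha_j,p_j)$ is tangent to a hedgehog with support function $p$ if $p_j=p(\alpha_j)$;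 a polygon is tangent to the hedgehog if all its sides are. Scaling by a factor $c$ with respect to the center (taken as the origin) multiplies the support function by $c$. *)

theory Defs
  imports "HOL-Analysis.Analysis" "HOL-Library.Real_Mod"
begin

text \<open>
  The Euclidean plane is \<^typ>\<open>complex\<close>, with \<open>\<bullet>\<close> the standard inner product. A pair
  \<open>(\<alpha>, p)\<close> stands for the cooriented line \<open>x cos \<alpha> + y sin \<alpha> = p\<close>. The angle is a real
  representative of a class modulo \<open>2\<pi>\<close>, so equality of cooriented lines is \<open>same_line\<close>,
  not equality of pairs.
\<close>

type_synonym cooriented_line = "real \<times> real"

definition same_line :: "cooriented_line \<Rightarrow> cooriented_line \<Rightarrow> bool" where
  "same_line l l' \<longleftrightarrow> [fst l = fst l'] (rmod (2 * pi)) \<and> snd l = snd l'"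

definition line_points :: "cooriented_line \<Rightarrow> complex set" where
  "line_points l = {z. Re z * cos (fst l) + Im z * sin (fst l) = snd l}"

definition line_normal :: "cooriented_line \<Rightarrow> complex" where
  "line_normal l = cis (fst l)"

definition line_direction :: "cooriented_line \<Rightarrow> complex" where
  "line_direction l = \<i> * line_normal l"

text \<open>The cooriented line through \<open>z\<close> whose coorienting normal has angle \<open>\<alpha>\<close>.\<close>

definition line_through :: "complex \<Rightarrow> real \<Rightarrow> cooriented_line" where
  "line_through z \<alpha> = (\<alpha>, z \<bullet> cis \<alpha>)"

lemma line_points_inner: "z \<in> line_points l \<longleftrightarrow> z \<bullet> line_normal l = snd l"
  by (simp add: line_points_def line_normal_def inner_complex_def)

lemma mem_line_through: "z \<in> line_points (line_through z \<alpha>)"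
  by (simp add: line_points_inner line_normal_def line_through_def)

lemma line_direction_quarter_turn:
  "line_direction (line_through z (fst l + pi / 2)) = \<i> * line_direction l"
  by (simp add: line_direction_def line_normal_def line_through_def
      complex_eq_iff cos_add sin_add)

text \<open>
  Cyclic sequences are indexed by all integers and are \<open>n\<close>-periodic as sequences of cooriented
  lines. The vertex \<open>P\<^bsub>j+1/2\<^esub>\<close> is \<open>vertex l j\<close>, and \<open>P\<^bsub>j-1/2\<^esub>\<close> is \<open>vertex l (j - 1)\<close>.
\<close>

definition cooriented_ngon :: "nat \<Rightarrow> (int \<Rightarrow> cooriented_line) \<Rightarrow> bool" where
  "cooriented_ngon n l \<longleftrightarrow>
     (\<forall>j. same_line (l (j + int n)) (l j)) \<and>
     (\<forall>j. \<exists>z. line_points (l j) \<inter> line_points (l (j + 1)) = {z})"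

definition vertex :: "(int \<Rightarrow> cooriented_line) \<Rightarrow> int \<Rightarrow> complex" where
  "vertex l j = (THE z. line_points (l j) \<inter> line_points (l (j + 1)) = {z})"

definition equiangular_hedgehog :: "nat \<Rightarrow> (int \<Rightarrow> cooriented_line) \<Rightarrow> bool" where
  "equiangular_hedgehog n l \<longleftrightarrow>
     cooriented_ngon n l \<and>
     (\<forall>j. [fst (l (j + 1)) - fst (l j) = 2 * pi / real n] (rmod (2 * pi)))"

definition P_evolute :: "(int \<Rightarrow> cooriented_line) \<Rightarrow> int \<Rightarrow> cooriented_line" where
  "P_evolute l j =
     line_through (midpoint (vertex l (j - 1)) (vertex l j)) (fst (l j) + pi / 2)"

lemma lines_meet_once_iff:
  "(\<exists>z. line_points l \<inter> line_points l' = {z}) \<longleftrightarrow> sin (fst l' - fst l) \<noteq> 0"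
proof
  assume "\<exists>z. line_points l \<inter> line_points l' = {z}"
  then obtain z where z: "line_points l \<inter> line_points l' = {z}" by blast
  show "sin (fst l' - fst l) \<noteq> 0"
  proof
    assume "sin (fst l' - fst l) = 0"
    then have "z + \<i> * cis (fst l) \<in> line_points l \<inter> line_points l'"
      using z by (auto simp: line_points_def sin_diff algebra_simps set_eq_iff)
    then show False using z by simp
  qed
next
  assume s: "sin (fst l' - fst l) \<noteq> 0"
  define a where "a = cos (fst l)"
  define b where "b = sin (fst l)"
  define a' where "a' = cos (fst l')"
  define b' where "b' = sin (fst l')"
  define D where "D = a * b' - b * a'"
  have D: "D \<noteq> 0"
    using s by (simp add: D_def a_def b_def a'_def b'_def sin_diff mult.commute)
  define z where "z = Complex ((snd l * b' - b * snd l') / D) ((a * snd l' - a' * snd l) / D)"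
  have "line_points l \<inter> line_points l' = {z}"
  proof (intro equalityI subsetI)
    fix w assume "w \<in> line_points l \<inter> line_points l'"
    then have w: "Re w * a + Im w * b = snd l" "Re w * a' + Im w * b' = snd l'"
      by (auto simp: line_points_def a_def b_def a'_def b'_def)
    have "Re w * D = snd l * b' - b * snd l'" "Im w * D = a * snd l' - a' * snd l"
      unfolding w[symmetric] D_def by algebra+
    then show "w \<in> {z}"
      using D by (simp add: z_def complex_eq_iff nonzero_eq_divide_eq)
  next
    fix w assume "w \<in> {z}"
    moreover have "(snd l * b' - b * snd l') * a + (a * snd l' - a' * snd l) * b = snd l * D"
      "(snd l * b' - b * snd l') * a' + (a * snd l' - a' * snd l) * b' = snd l' * D"
      unfolding D_def by algebra+
    then have "Re z * a + Im z * b = snd l" "Re z * a' + Im z * b' = snd l'"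
      using D by (simp_all add: z_def add_divide_distrib[symmetric] nonzero_divide_eq_eq)
    ultimately show "w \<in> line_points l \<inter> line_points l'"
      by (simp add: line_points_def a_def b_def a'_def b'_def)
  qed
  then show "\<exists>z. line_points l \<inter> line_points l' = {z}" by blast
qed

lemma same_line_points:
  assumes "same_line l l'"
  shows "line_points l = line_points l'"
proof -
  obtain k where "fst l' = fst l + of_int k * (2 * pi)"
    using assms by (auto simp: same_line_def rcong_altdef)
  then have "fst l' = fst l + 2 * pi * of_int k" by simp
  then have "cos (fst l') = cos (fst l)" "sin (fst l') = sin (fst l)"
    by (simp_all add: cos_add sin_add)
  then show ?thesis
    using assms by (simp add: line_points_def same_line_def)
qed

lemma cooriented_ngon_P_evolute:
  assumes "cooriented_ngon n l"
  shows "cooriented_ngon n (P_evolute l)"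
proof -
  have per: "same_line (l (j + int n)) (l j)" for j
    using assms by (simp add: cooriented_ngon_def)
  have v: "vertex l (j + int n) = vertex l j" for j
    using same_line_points[OF per[of j]] same_line_points[OF per[of "j + 1"]]
    by (simp add: vertex_def algebra_simps)
  have "same_line (P_evolute l (j + int n)) (P_evolute l j)" for j
  proof -
    have f: "[fst (l (j + int n)) = fst (l j)] (rmod (2 * pi))"
      using per[of j] by (simp add: same_line_def)
    then obtain k where "fst (l j) = fst (l (j + int n)) + of_int k * (2 * pi)"
      by (auto simp: rcong_altdef)
    then have "fst (l j) = fst (l (j + int n)) + 2 * pi * of_int k" by simp
    then have "cis (fst (l (j + int n)) + pi / 2) = cis (fst (l j) + pi / 2)"
      by (simp add: complex_eq_iff cos_add sin_add)
    moreover have "[fst (l (j + int n)) + pi / 2 = fst (l j) + pi / 2] (rmod (2 * pi))"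
      by (intro rcong_intros f)
    ultimately show ?thesis
      using v[of j] v[of "j - 1"]
      by (simp add: P_evolute_def same_line_def line_through_def algebra_simps)
  qed
  moreover have "sin (fst (P_evolute l (j + 1)) - fst (P_evolute l j)) \<noteq> 0" for j
    using assms by (simp add: cooriented_ngon_def lines_meet_once_iff P_evolute_def line_through_def)
  ultimately show ?thesis
    by (simp add: cooriented_ngon_def lines_meet_once_iff)
qed

text \<open>
  A smooth hedgehog is represented by its support function. Its tangent line with angle \<open>\<alpha>\<close> is
  \<open>(\<alpha>, p \<alpha>)\<close>, and \<open>hedgehog_point p\<close> parametrizes the envelope of these lines: it solves
  \<open>z \<bullet> cis \<alpha> = p \<alpha>\<close> together with the equation differentiated with respect to \<open>\<alpha>\<close>.
\<close>

definition hedgehog_point :: "(real \<Rightarrow> real) \<Rightarrow> real \<Rightarrow> complex" where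
  "hedgehog_point p \<alpha> = p \<alpha> *\<^sub>R cis \<alpha> + deriv p \<alpha> *\<^sub>R (\<i> * cis \<alpha>)"

text \<open>The normal at the point with tangent angle \<open>\<alpha>\<close>, cooriented by \<open>\<alpha> + \<pi>/2\<close>.\<close>

definition hedgehog_normal :: "(real \<Rightarrow> real) \<Rightarrow> real \<Rightarrow> cooriented_line" where
  "hedgehog_normal p \<alpha> = line_through (hedgehog_point p \<alpha>) (\<alpha> + pi / 2)"

text \<open>
  The envelope of the normals is the hedgehog whose tangent line with angle \<open>\<alpha>\<close> is
  \<open>hedgehog_normal p (\<alpha> - \<pi>/2)\<close>.
\<close>

definition evolute :: "(real \<Rightarrow> real) \<Rightarrow> real \<Rightarrow> real" where
  "evolute p \<alpha> = snd (hedgehog_normal p (\<alpha> - pi / 2))"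

lemma evolute_eq: "evolute p \<alpha> = deriv p (\<alpha> - pi / 2)"
proof -
  have "(sin \<alpha>)\<^sup>2 + (cos \<alpha>)\<^sup>2 = 1" by simp
  then have "deriv p (\<alpha> - pi / 2) * (sin \<alpha>)\<^sup>2 + deriv p (\<alpha> - pi / 2) * (cos \<alpha>)\<^sup>2
      = deriv p (\<alpha> - pi / 2)"
    by (metis distrib_left mult.right_neutral)
  then show ?thesis
    by (simp add: evolute_def hedgehog_normal_def hedgehog_point_def line_through_def
        inner_complex_def cos_diff sin_diff algebra_simps power2_eq_square)
qed

text \<open>
  A hypocycloid of order \<open>m\<close> with center \<open>c\<close> is a translate by \<open>c\<close> of one centered at the
  origin; translation by \<open>c\<close> adds \<open>c \<bullet> cis \<alpha>\<close> to a support function.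
\<close>

definition hypocycloid :: "nat \<Rightarrow> complex \<Rightarrow> (real \<Rightarrow> real) \<Rightarrow> bool" where
  "hypocycloid m c p \<longleftrightarrow>
     (\<exists>a b. \<forall>\<alpha>. p \<alpha> = c \<bullet> cis \<alpha> + a * cos (real m * \<alpha>) + b * sin (real m * \<alpha>))"

definition scale_about :: "complex \<Rightarrow> real \<Rightarrow> (real \<Rightarrow> real) \<Rightarrow> real \<Rightarrow> real" where
  "scale_about c k p \<alpha> = c \<bullet> cis \<alpha> + k * (p \<alpha> - c \<bullet> cis \<alpha>)"

lemma hypocycloid_origin:
  "hypocycloid m 0 p \<longleftrightarrow> (\<exists>a b. \<forall>\<alpha>. p \<alpha> = a * cos (real m * \<alpha>) + b * sin (real m * \<alpha>))"
  by (simp add: hypocycloid_def)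

lemma scale_about_origin: "scale_about 0 k p \<alpha> = k * p \<alpha>"
  by (simp add: scale_about_def)

lemma hedgehog_point_scale_about:
  assumes "p differentiable (at \<alpha>)"
  shows "hedgehog_point (scale_about c k p) \<alpha> = c + k *\<^sub>R (hedgehog_point p \<alpha> - c)"
proof -
  have p: "(p has_real_derivative deriv p \<alpha>) (at \<alpha>)"
    using assms by (simp add: DERIV_deriv_iff_real_differentiable)
  have "((\<lambda>\<alpha>. Re c * cos \<alpha> + Im c * sin \<alpha>
          + k * (p \<alpha> - (Re c * cos \<alpha> + Im c * sin \<alpha>))) has_real_derivative
        (- Re c * sin \<alpha> + Im c * cos \<alpha>
          + k * (deriv p \<alpha> - (- Re c * sin \<alpha> + Im c * cos \<alpha>)))) (at \<alpha>)"
    by (auto intro!: derivative_eq_intros p)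
  then have D: "deriv (scale_about c k p) \<alpha> = - Re c * sin \<alpha> + Im c * cos \<alpha>
          + k * (deriv p \<alpha> - (- Re c * sin \<alpha> + Im c * cos \<alpha>))"
    by (intro DERIV_imp_deriv) (simp add: scale_about_def[abs_def] inner_complex_def)
  have *: "x * (sin \<alpha> * sin \<alpha>) = x - x * (cos \<alpha> * cos \<alpha>)" for x
    using sin_squared_eq[of \<alpha>] by (simp add: power2_eq_square right_diff_distrib)
  show ?thesis
    unfolding hedgehog_point_def D
    by (simp add: complex_eq_iff scale_about_def inner_complex_def algebra_simps *)
qed

definition line_tangent :: "cooriented_line \<Rightarrow> (real \<Rightarrow> real) \<Rightarrow> bool" where
  "line_tangent l p \<longleftrightarrow> snd l = p (fst l)"

definition polygon_tangent :: "(int \<Rightarrow> cooriented_line) \<Rightarrow> (real \<Rightarrow> real) \<Rightarrow> bool" where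
  "polygon_tangent l p \<longleftrightarrow> (\<forall>j. line_tangent (l j) p)"

end

theory Submission
  imports Defs
begin

text \<open>
  With \<open>\<delta> = 2\<pi>/n\<close>, intersecting \<open>l\<^sub>j\<close> with \<open>l\<^bsub>j\<plusminus>1\<^esub>\<close> gives the tangential coordinate
  \<open>\<plusminus>(p\<^bsub>j\<plusminus>1\<^esub> - p\<^sub>j cos \<delta>) / sin \<delta>\<close> of the vertices on \<open>l\<^sub>j\<close>, so the evolute has the central
  difference quotient \<open>(p\<^bsub>j+1\<^esub> - p\<^bsub>j-1\<^esub>) / (2 sin \<delta>)\<close> as support number. On the functions of
  order \<open>m\<close>, this quotient is the derivative times \<open>sin (m\<delta>) / (m sin \<delta>)\<close>; on those of
  order \<open>1\<close>, which describe translations, it is exactly the derivative.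
\<close>

lemma vertex_mem:
  assumes "cooriented_ngon n l"
  shows "vertex l j \<in> line_points (l j) \<inter> line_points (l (j + 1))"
proof -
  obtain z where z: "line_points (l j) \<inter> line_points (l (j + 1)) = {z}"
    using assms unfolding cooriented_ngon_def by blast
  then have "vertex l j = z"
    by (auto simp: vertex_def)
  then show ?thesis
    using z by simp
qed

lemma rcong_angle_add:
  assumes "[\<beta> - \<alpha> = \<delta>] (rmod (2 * pi))"
  shows "\<exists>k::int. \<beta> = \<alpha> + \<delta> + 2 * pi * of_int k"
proof -
  obtain k where "\<delta> = \<beta> - \<alpha> + of_int k * (2 * pi)"
    using assms by (auto simp: rcong_altdef)
  then have "\<beta> = \<alpha> + \<delta> + 2 * pi * of_int (- k)"
    by simp
  then show ?thesis ..
qed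

lemma cis_add_2pi_int: "cis (x + 2 * pi * of_int k) = cis x"
  by (simp add: complex_eq_iff cos_add sin_add)

lemma equiangular_hedgehog_step:
  assumes "equiangular_hedgehog n l"
  shows "\<exists>k::int. fst (l (j + 1)) = fst (l j) + 2 * pi / real n + 2 * pi * of_int k"
  using assms by (intro rcong_angle_add) (simp add: equiangular_hedgehog_def)

text \<open>Parallel neighbouring sides could not meet in a single point. Any pair of neighbours
  gives this, here the sides 0 and 1.\<close>

lemma sin_turning_angle_nonzero:
  assumes "equiangular_hedgehog n l"
  shows "sin (2 * pi / real n) \<noteq> 0"
proof -
  obtain k :: int where "fst (l (0 + 1)) = fst (l 0) + 2 * pi / real n + 2 * pi * of_int k"
    using equiangular_hedgehog_step[OF assms] by blast
  then have "sin (fst (l (0 + 1)) - fst (l 0)) = sin (2 * pi / real n)"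
    by (simp add: sin_add)
  moreover have "\<exists>z. line_points (l 0) \<inter> line_points (l (0 + 1)) = {z}"
    using assms unfolding equiangular_hedgehog_def cooriented_ngon_def by blast
  ultimately show ?thesis
    unfolding lines_meet_once_iff by simp
qed

text \<open>Expands the normal of a neighbouring side in the orthonormal frame
  \<open>cis \<alpha>\<close>, \<open>cis (\<alpha> + pi / 2)\<close>. The second coefficient
  carries the tangential coordinate of a vertex.\<close>

lemma inner_cis_add:
  "z \<bullet> cis (\<alpha> + \<delta>) = cos \<delta> * (z \<bullet> cis \<alpha>) + sin \<delta> * (z \<bullet> cis (\<alpha> + pi / 2))"
  by (simp add: inner_complex_def cos_add sin_add algebra_simps)

lemma inner_vertex:
  assumes "equiangular_hedgehog n l"
  shows "vertex l j \<bullet> cis (fst (l j)) = snd (l j)"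
    and "vertex l j \<bullet> cis (fst (l (j + 1))) = snd (l (j + 1))"
  using assms vertex_mem[of n l j]
  by (auto simp: equiangular_hedgehog_def line_points_inner line_normal_def)

lemma snd_P_evolute:
  assumes "equiangular_hedgehog n l"
  shows "snd (P_evolute l j)
    = (snd (l (j + 1)) - snd (l (j - 1))) / (2 * sin (2 * pi / real n))"
proof -
  define \<delta> where "\<delta> = 2 * pi / real n"
  define \<alpha> where "\<alpha> = fst (l j)"
  define u where "u = cis (\<alpha> + pi / 2)"
  obtain k where k: "fst (l (j + 1)) = \<alpha> + \<delta> + 2 * pi * of_int k"
    using equiangular_hedgehog_step[OF assms] by (auto simp: \<alpha>_def \<delta>_def)
  obtain k' where "\<alpha> = fst (l (j - 1)) + \<delta> + 2 * pi * of_int k'"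
    using equiangular_hedgehog_step[OF assms, of "j - 1"] by (auto simp: \<alpha>_def \<delta>_def)
  \<comment> \<open>Seen from side \<open>j\<close>, the previous side is turned by -\<delta>, which
    flips the sign of the sine term below.\<close>
  then have k': "fst (l (j - 1)) = \<alpha> + (- \<delta>) + 2 * pi * of_int (- k')"
    by simp
  have next_line: "snd (l (j + 1)) = cos \<delta> * snd (l j) + sin \<delta> * (vertex l j \<bullet> u)"
    using inner_vertex[OF assms, of j]
    unfolding k cis_add_2pi_int inner_cis_add[of _ \<alpha> \<delta>] u_def by (simp add: \<alpha>_def)
  have prev_line:
    "snd (l (j - 1)) = cos \<delta> * snd (l j) - sin \<delta> * (vertex l (j - 1) \<bullet> u)"
    using inner_vertex[OF assms, of "j - 1"]
    unfolding k' cis_add_2pi_int inner_cis_add[of _ \<alpha> "- \<delta>"] u_def by (simp add: \<alpha>_def)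
  have "snd (P_evolute l j) = (vertex l (j - 1) \<bullet> u + vertex l j \<bullet> u) / 2"
    by (simp add: P_evolute_def line_through_def midpoint_def inner_add_left u_def \<alpha>_def)
  moreover have "sin \<delta> \<noteq> 0"
    using sin_turning_angle_nonzero[OF assms] by (simp add: \<delta>_def)
  \<comment> \<open>In the difference of the two neighbours the terms
    \<open>cos \<delta> * snd (l j)\<close> cancel, leaving sin \<delta> times the sum of the
    tangential coordinates.\<close>
  ultimately show ?thesis
    unfolding next_line prev_line \<delta>_def[symmetric] by (simp add: field_simps)
qed

text \<open>Since \<open>m\<close> is an integer, full turns of x become full turns of m x. This
  matters because the angles of the sides are only controlled modulo 2 pi.\<close>

lemma hypocycloid_periodic:
  assumes "hypocycloid m c h"
  shows "h (x + 2 * pi * of_int k) = h x"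
proof -
  have "real m * (x + 2 * pi * of_int k) = real m * x + 2 * pi * of_int (int m * k)"
    by (simp add: algebra_simps)
  then have "cis (real m * (x + 2 * pi * of_int k)) = cis (real m * x)"
    by (simp only: cis_add_2pi_int)
  then show ?thesis
    using assms by (auto simp: hypocycloid_def cis_add_2pi_int complex_eq_iff)
qed

lemma hypocycloid_central_difference:
  assumes "hypocycloid m c h" and "m \<ge> 1"
  shows "h (\<alpha> + \<delta>) - h (\<alpha> - \<delta>)
    = 2 * sin \<delta> * (c \<bullet> cis (\<alpha> + pi / 2))
      + 2 * sin (real m * \<delta>) / real m * (deriv h \<alpha> - c \<bullet> cis (\<alpha> + pi / 2))"
proof -
  obtain a b where h: "h x = c \<bullet> cis x + a * cos (real m * x) + b * sin (real m * x)" for x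
    using assms(1) by (auto simp: hypocycloid_def)
  \<comment> \<open>The summand \<open>c \<bullet> cis (\<alpha> + pi / 2)\<close> is the derivative
    of the translation part \<open>c \<bullet> cis \<alpha>\<close>.\<close>
  have "(h has_real_derivative (c \<bullet> cis (\<alpha> + pi / 2)
      + real m * (b * cos (real m * \<alpha>) - a * sin (real m * \<alpha>)))) (at \<alpha>)"
    unfolding h[abs_def] inner_complex_def
    by (auto intro!: derivative_eq_intros simp: cos_add sin_add algebra_simps)
  then have "deriv h \<alpha> - c \<bullet> cis (\<alpha> + pi / 2)
      = real m * (b * cos (real m * \<alpha>) - a * sin (real m * \<alpha>))"
    by (simp add: DERIV_imp_deriv)
  then show ?thesis
    using assms(2)
    by (simp add: h inner_complex_def distrib_left right_diff_distrib cos_add sin_add cos_diff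
        sin_diff)
qed

theorem theorem5:
  fixes n m :: nat
    and P :: "int \<Rightarrow> cooriented_line"
    and h :: "real \<Rightarrow> real"
    and c :: complex
  assumes "n \<ge> 3"
    and "m \<ge> 1"
    and "equiangular_hedgehog n P"
    and "hypocycloid m c h"
    and "polygon_tangent P h"
  shows "polygon_tangent (P_evolute P)
           (scale_about c (sin (2 * pi * real m / real n) / (real m * sin (2 * pi / real n)))
             (evolute h))"
  unfolding polygon_tangent_def line_tangent_def
proof
  fix j
  define \<delta> where "\<delta> = 2 * pi / real n"
  define \<alpha> where "\<alpha> = fst (P j)"
  have tangent: "snd (P i) = h (fst (P i))" for i
    using assms(5) by (simp add: polygon_tangent_def line_tangent_def)
  have periodic: "h (x + 2 * pi * of_int k) = h x" for x and k :: int
    using assms(4) by (rule hypocycloid_periodic)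
  obtain k where k: "fst (P (j + 1)) = \<alpha> + \<delta> + 2 * pi * of_int k"
    using equiangular_hedgehog_step[OF assms(3)] by (auto simp: \<alpha>_def \<delta>_def)
  obtain k' where "\<alpha> = fst (P (j - 1)) + \<delta> + 2 * pi * of_int k'"
    using equiangular_hedgehog_step[OF assms(3), of "j - 1"] by (auto simp: \<alpha>_def \<delta>_def)
  then have k': "fst (P (j - 1)) = \<alpha> - \<delta> + 2 * pi * of_int (- k')"
    by simp
  have "snd (P_evolute P j) = (h (\<alpha> + \<delta>) - h (\<alpha> - \<delta>)) / (2 * sin \<delta>)"
    unfolding snd_P_evolute[OF assms(3)] tangent k k' periodic \<delta>_def ..
  also have "\<dots> = c \<bullet> cis (\<alpha> + pi / 2)
      + sin (real m * \<delta>) / (real m * sin \<delta>) * (deriv h \<alpha> - c \<bullet> cis (\<alpha> + pi / 2))"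
    using sin_turning_angle_nonzero[OF assms(3)]
    unfolding hypocycloid_central_difference[OF assms(4,2)] \<delta>_def[symmetric]
    by (simp add: add_divide_distrib)
  \<comment> \<open>The side of the evolute has angle \<alpha> + pi/2, where
    \<open>evolute h\<close> takes the value \<open>deriv h \<alpha>\<close>: the two quarter turns
    cancel.\<close>
  also have "\<dots> = scale_about c
      (sin (2 * pi * real m / real n) / (real m * sin (2 * pi / real n)))
      (evolute h) (fst (P_evolute P j))"
    by (simp add: scale_about_def evolute_eq P_evolute_def line_through_def \<alpha>_def \<delta>_def
        mult.commute)
  finally show "snd (P_evolute P j) = scale_about c
      (sin (2 * pi * real m / real n) / (real m * sin (2 * pi / real n)))
      (evolute h) (fst (P_evolute P j))" .
qed

end
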